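(* Let $\mathcal{S}$ be a collection of monomial ideals in the polynomial ring $\mathbb{Q}[X]=\mathbb{Q}[X_1,\dots,X_n]$, and let $\mathcal{M}_1,\mathcal{M}_2,\dots$ be an infinite sequence of collections of monomial ideals from $\mathcal{S}$ (that is, $\mathcal{M}_i\subseteq\mathcal{S}$ for all $i$), where each $\mathcal{M}_i$ is closed under inclusion: if $I\in\mathcal{M}_i$ and $J\in\mathcal{S}$ is a monomial ideal such that $J\subseteq I$, then $J\in\mathcal{M}_i$. Then $\mathcal{M}_i\subseteq\mathcal{M}_j$ for some indices $i\neq j$.
   Context: A monomial ideal of $\mathbb{Q}[X_1,\dots,X_n]$ is an ideal generated by monomials $X^\nu=X_1^{\nu_1}\cdots X_n^{\nu_n}$, $\nu=(\nu_1,\dots,\nu_n)\in\mathbb{N}^n$. *)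

theory Defs
  imports Complex_Main "HOL-Library.Poly_Mapping" "HOL-Algebra.Ideal"
begin

text \<open>An exponent vector \<open>\<nu> \<in> \<nat>\<^sup>n\<close> is a finitely supported map with support in \<open>{1..n}\<close>;
  a polynomial maps exponent vectors to coefficients, and the product on
  \<open>(nat \<Rightarrow>\<^sub>0 nat) \<Rightarrow>\<^sub>0 rat\<close> is the convolution product of polynomials.\<close>

definition exponents :: "nat \<Rightarrow> (nat \<Rightarrow>\<^sub>0 nat) set"
  where "exponents n = {\<nu>. Poly_Mapping.keys \<nu> \<subseteq> {1..n}}"

definition rat_poly_ring :: "nat \<Rightarrow> ((nat \<Rightarrow>\<^sub>0 nat) \<Rightarrow>\<^sub>0 rat) ring"
  where "rat_poly_ring n =
    \<lparr>carrier = {p. Poly_Mapping.keys p \<subseteq> exponents n},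
     monoid.mult = (*), one = 1, zero = 0, add = (+)\<rparr>"

definition power_product :: "(nat \<Rightarrow>\<^sub>0 nat) \<Rightarrow> ((nat \<Rightarrow>\<^sub>0 nat) \<Rightarrow>\<^sub>0 rat)"
  where "power_product \<nu> = Poly_Mapping.single \<nu> 1"

definition monomial_ideal :: "nat \<Rightarrow> ((nat \<Rightarrow>\<^sub>0 nat) \<Rightarrow>\<^sub>0 rat) set \<Rightarrow> bool"
  where "monomial_ideal n I \<longleftrightarrow>
    (\<exists>A \<subseteq> exponents n. I = genideal (rat_poly_ring n) (power_product ` A))"

lemma exponents_zero: "0 \<in> exponents n"
  by (simp add: exponents_def)

lemma exponents_add: "\<mu> \<in> exponents n \<Longrightarrow> \<nu> \<in> exponents n \<Longrightarrow> \<mu> + \<nu> \<in> exponents n"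
  unfolding exponents_def using Poly_Mapping.keys_add[of \<mu> \<nu>] by blast

lemma cring_rat_poly_ring: "cring (rat_poly_ring n)"
proof (rule cringI)
  show "abelian_group (rat_poly_ring n)"
  proof (rule abelian_groupI)
    fix x y assume "x \<in> carrier (rat_poly_ring n)" "y \<in> carrier (rat_poly_ring n)"
    then show "x \<oplus>\<^bsub>rat_poly_ring n\<^esub> y \<in> carrier (rat_poly_ring n)"
      using Poly_Mapping.keys_add[of x y] by (auto simp: rat_poly_ring_def)
  next
    fix x assume "x \<in> carrier (rat_poly_ring n)"
    then have "- x \<in> carrier (rat_poly_ring n)"
      by (simp add: rat_poly_ring_def keys.rep_eq)
    then show "\<exists>y\<in>carrier (rat_poly_ring n). y \<oplus>\<^bsub>rat_poly_ring n\<^esub> x = \<zero>\<^bsub>rat_poly_ring n\<^esub>"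
      by (intro bexI[of _ "- x"]) (simp_all add: rat_poly_ring_def)
  qed (simp_all add: rat_poly_ring_def ac_simps)
  show "comm_monoid (rat_poly_ring n)"
  proof (rule comm_monoidI)
    fix x y assume "x \<in> carrier (rat_poly_ring n)" "y \<in> carrier (rat_poly_ring n)"
    then show "x \<otimes>\<^bsub>rat_poly_ring n\<^esub> y \<in> carrier (rat_poly_ring n)"
      using Poly_Mapping.keys_mult[of x y] by (fastforce simp: rat_poly_ring_def intro: exponents_add)
  qed (simp_all add: rat_poly_ring_def exponents_zero ac_simps)
qed (simp add: rat_poly_ring_def distrib_right)

lemma power_product_in_carrier:
  "\<nu> \<in> exponents n \<Longrightarrow> power_product \<nu> \<in> carrier (rat_poly_ring n)"
  by (simp add: power_product_def rat_poly_ring_def)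

lemma ideal_monomial_ideal:
  assumes "monomial_ideal n I"
  shows "ideal I (rat_poly_ring n)"
proof -
  interpret cring "rat_poly_ring n" by (rule cring_rat_poly_ring)
  show ?thesis
    using assms unfolding monomial_ideal_def
    by (auto intro!: genideal_ideal power_product_in_carrier)
qed

end

theory Submission
  imports Defs "HOL-Library.Ramsey"
begin

text \<open>
  Suppose that no \<open>M i\<close> is contained in another \<open>M j\<close>, and choose \<open>I i j \<in> M i - M j\<close>.
  Since \<open>I j k\<close> lies in \<open>M j\<close>, and \<open>M j\<close> contains with every ideal the smaller ideals of \<open>S\<close>,
  while \<open>I i j\<close> does not lie in \<open>M j\<close>, there is no inclusion \<open>I i j \<subseteq> I j k\<close>. This is witnessed by
  a monomial with exponent \<open>\<nu> i j k\<close> that lies in \<open>I i j\<close> and not in \<open>I j k\<close>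
  (\<open>monomial_ideal_not_subsetE\<close>). Hence the monomial of \<open>\<nu> j k l\<close>, which does lie in \<open>I j k\<close>,
  cannot divide the monomial of \<open>\<nu> i j k\<close>, because ideals are closed under multiples
  (\<open>power_product_multiple_in_ideal\<close>).

  All this needs only that consecutive indices differ, so they may be taken in decreasing order.
  Then \<open>f a b c = \<nu> c b a\<close> becomes a map from increasing triples
  of naturals to exponent vectors such that \<open>f a b c \<le> f b c d\<close> fails for all \<open>a < b < c < d\<close>.
  Such a map does not exist (\<open>ascending_step_on_triples\<close>): this is the part of the statement
  that \<open>\<nat>\<^sup>n\<close> is a better quasi-order that concerns triples, and it follows from Ramsey's theorem.
\<close>

text \<open>
  If every step from \<open>(a, b, c)\<close> to \<open>(b, c, d)\<close> were to decrease some coordinate, one could colour the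
  four-element set \<open>{a, b, c, d}\<close> by such a coordinate. On an infinite homogeneous set
  \<open>h 0 < h 1 < \<dots>\<close> it is the same coordinate throughout, which then decreases forever along
  the consecutive triples \<open>(h m, h (m + 1), h (m + 2))\<close>.
\<close>

lemma ascending_step_on_triples:
  fixes f :: "nat \<Rightarrow> nat \<Rightarrow> nat \<Rightarrow> nat \<Rightarrow> 'b::wellorder"
  shows "\<exists>a b c d. a < b \<and> b < c \<and> c < d \<and> (\<forall>k\<in>{1..n}. f a b c k \<le> f b c d k)"
proof (rule ccontr)
  assume contra: "\<not> ?thesis"
  define bad where "bad a b c d k \<longleftrightarrow> k \<in> {1..n} \<and> f b c d k < f a b c k" for a b c d k
  define colour where "colour Z = (let l = sorted_list_of_set Z in
      SOME k. bad (l ! 0) (l ! 1) (l ! 2) (l ! 3) k)" for Z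
  have colour_bad: "bad a b c d (colour {a, b, c, d})" if "a < b" "b < c" "c < d" for a b c d
  proof -
    have "sorted_list_of_set (set [a, b, c, d]) = [a, b, c, d]"
      using that by (intro sorted_list_of_set.idem_if_sorted_distinct) auto
    then have "colour {a, b, c, d} = (SOME k. bad a b c d k)"
      by (simp add: colour_def)
    moreover have "\<exists>k. bad a b c d k"
      using contra that unfolding bad_def by (meson not_le)
    ultimately show ?thesis
      by (simp add: someI_ex)
  qed
  have "colour Z < Suc n" if "finite Z" "card Z = 4" for Z
  proof -
    have "\<exists>a b c d. l = [a, b, c, d]" if "length l = 4" for l :: "nat list"
      using that by (auto simp: length_Suc_conv numeral_eq_Suc)
    then obtain a b c d where l: "sorted_list_of_set Z = [a, b, c, d]"
      using \<open>card Z = 4\<close> by (metis length_sorted_list_of_set)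
    then have "Z = {a, b, c, d}"
      using set_sorted_list_of_set[OF \<open>finite Z\<close>] by simp
    moreover have "a < b" "b < c" "c < d"
      using strict_sorted_list_of_set[of Z] by (simp_all add: l)
    ultimately show ?thesis
      using colour_bad by (simp add: bad_def less_Suc_eq_le)
  qed
  then obtain H t where H: "infinite H"
    and t: "\<And>Z. Z \<subseteq> H \<Longrightarrow> finite Z \<Longrightarrow> card Z = 4 \<Longrightarrow> colour Z = t"
    using Ramsey[of "UNIV :: nat set" 4 colour "Suc n"] by auto
  define h where "h = enumerate H"
  have h: "h m < h (Suc m)" "h m \<in> H" for m
    using H by (auto simp: h_def enumerate_step enumerate_in_set)
  define s where "s m = f (h m) (h (Suc m)) (h (Suc (Suc m))) t" for m
  have descent: "s (Suc m) < s m" for m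
  proof -
    let ?a = "h m" and ?b = "h (Suc m)" and ?c = "h (Suc (Suc m))" and ?d = "h (Suc (Suc (Suc m)))"
    have less: "?a < ?b" "?b < ?c" "?c < ?d"
      by (rule h)+
    then have "card {?a, ?b, ?c, ?d} = 4"
      by simp
    then have "colour {?a, ?b, ?c, ?d} = t"
      using h by (intro t) auto
    then show ?thesis
      using colour_bad[OF less] by (simp add: bad_def s_def)
  qed
  obtain m where "s m = (LEAST x. x \<in> range s)"
    using LeastI[of "\<lambda>x. x \<in> range s" "s 0"] by (metis rangeE rangeI)
  then have "s m \<le> s (Suc m)"
    by (simp add: Least_le)
  with descent[of m] show False
    by simp
qed

lemma power_product_multiple_in_ideal:
  assumes "ideal I (rat_poly_ring n)" "power_product \<nu> \<in> I" "\<mu> \<in> exponents n"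
    and le: "\<And>k. Poly_Mapping.lookup \<nu> k \<le> Poly_Mapping.lookup \<mu> k"
  shows "power_product \<mu> \<in> I"
proof -
  have keys: "Poly_Mapping.keys (\<mu> - \<nu>) \<subseteq> Poly_Mapping.keys \<mu>"
    by (auto simp: in_keys_iff lookup_minus)
  have sum: "(\<mu> - \<nu>) + \<nu> = \<mu>"
    by (rule poly_mapping_eqI) (simp add: lookup_add lookup_minus le)
  have "power_product (\<mu> - \<nu>) \<in> carrier (rat_poly_ring n)"
    using keys assms(3) by (intro power_product_in_carrier) (auto simp: exponents_def)
  then have "power_product (\<mu> - \<nu>) \<otimes>\<^bsub>rat_poly_ring n\<^esub> power_product \<nu> \<in> I"
    by (rule ideal.I_l_closed[OF assms(1,2)])
  moreover have "power_product (\<mu> - \<nu>) \<otimes>\<^bsub>rat_poly_ring n\<^esub> power_product \<nu> = power_product \<mu>"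
    by (simp add: rat_poly_ring_def power_product_def mult_single sum)
  ultimately show ?thesis
    by simp
qed

text \<open>
  The ideal \<open>J\<close> omits one of the generating monomials of \<open>I\<close>, since \<open>I\<close> is the least ideal
  that contains them all.
\<close>

lemma monomial_ideal_not_subsetE:
  assumes "monomial_ideal n I" "ideal J (rat_poly_ring n)" "\<not> I \<subseteq> J"
  obtains \<nu> where "\<nu> \<in> exponents n" "power_product \<nu> \<in> I" "power_product \<nu> \<notin> J"
proof -
  interpret R: cring "rat_poly_ring n"
    by (rule cring_rat_poly_ring)
  obtain A where A: "A \<subseteq> exponents n" and I: "I = genideal (rat_poly_ring n) (power_product ` A)"
    using assms(1) by (auto simp: monomial_ideal_def)
  have "power_product ` A \<subseteq> I"
    unfolding I using A by (intro R.genideal_self) (auto intro: power_product_in_carrier)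
  moreover have "\<not> power_product ` A \<subseteq> J"
    using R.genideal_minimal[OF assms(2)] assms(3) I by blast
  ultimately show thesis
    using A that by blast
qed

theorem mainTheorem1:
  fixes n :: nat
    and S :: "((nat \<Rightarrow>\<^sub>0 nat) \<Rightarrow>\<^sub>0 rat) set set"
    and M :: "nat \<Rightarrow> ((nat \<Rightarrow>\<^sub>0 nat) \<Rightarrow>\<^sub>0 rat) set set"
  assumes "\<forall>I\<in>S. monomial_ideal n I"
    and "\<And>i. M i \<subseteq> S"
    and "\<And>i I J. I \<in> M i \<Longrightarrow> J \<in> S \<Longrightarrow> J \<subseteq> I \<Longrightarrow> J \<in> M i"
  shows "\<exists>i j. i \<noteq> j \<and> M i \<subseteq> M j"
proof (rule ccontr)
  assume "\<not> ?thesis"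
  then have "\<forall>i j. \<exists>I. i \<noteq> j \<longrightarrow> I \<in> M i \<and> I \<notin> M j"
    by blast
  then obtain I where I: "\<And>i j. i \<noteq> j \<Longrightarrow> I i j \<in> M i \<and> I i j \<notin> M j"
    by metis
  have monomial: "monomial_ideal n (I i j)" if "i \<noteq> j" for i j
    using I[OF that] assms(1,2) by blast
  note ideal = ideal_monomial_ideal[OF monomial]
  have "\<exists>\<nu>. i \<noteq> j \<and> j \<noteq> k \<longrightarrow>
      \<nu> \<in> exponents n \<and> power_product \<nu> \<in> I i j \<and> power_product \<nu> \<notin> I j k" for i j k
  proof (cases "i \<noteq> j \<and> j \<noteq> k")
    case True
    then have "\<not> I i j \<subseteq> I j k"
      using I assms(2,3) by (meson subsetD)
    then show ?thesis
      using True by (metis monomial_ideal_not_subsetE monomial ideal)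
  qed blast
  then obtain \<nu> where \<nu>: "\<And>i j k. i \<noteq> j \<Longrightarrow> j \<noteq> k \<Longrightarrow>
      \<nu> i j k \<in> exponents n \<and> power_product (\<nu> i j k) \<in> I i j \<and> power_product (\<nu> i j k) \<notin> I j k"
    by metis
  \<comment> \<open>The indices are reversed: an ascending step must give divisibility from
    \<open>\<nu> c b a\<close>, which lies in \<open>I c b\<close>, to \<open>\<nu> d c b\<close>, which avoids \<open>I c b\<close>.\<close>
  obtain a b c d where less: "a < b" "b < c" "c < d"
    and le: "\<forall>k\<in>{1..n}. Poly_Mapping.lookup (\<nu> c b a) k \<le> Poly_Mapping.lookup (\<nu> d c b) k"
    using ascending_step_on_triples[of n "\<lambda>a b c k. Poly_Mapping.lookup (\<nu> c b a) k"] by blast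
  have "Poly_Mapping.lookup (\<nu> c b a) k \<le> Poly_Mapping.lookup (\<nu> d c b) k" for k
  proof (cases "k \<in> {1..n}")
    case False
    then have "k \<notin> Poly_Mapping.keys (\<nu> c b a)"
      using \<nu>[of c b a] less by (auto simp: exponents_def)
    then show ?thesis
      by (simp add: in_keys_iff)
  qed (use le in blast)
  moreover have "ideal (I c b) (rat_poly_ring n)"
    using less by (simp add: ideal)
  moreover have "power_product (\<nu> c b a) \<in> I c b" "\<nu> d c b \<in> exponents n"
    using \<nu>[of c b a] \<nu>[of d c b] less by simp_all
  ultimately have "power_product (\<nu> d c b) \<in> I c b"
    by (metis power_product_multiple_in_ideal)
  then show False
    using \<nu>[of d c b] less by simp
qed

end
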